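(* For any distance space $(X,d)$, the compression map $\pi\colon\mathsf{Cob}(X,d)\to X$ is a continuous monotone quotient surjection, and $\mathsf{Cob}(X,d)$ is connected if and only if $(X,d)$ is connected. Moreover, $\pi$ is hereditarily quotient if and only if $(X,d)$ is well-behaved.
   Context: A distance space is a pair $(X,d)$ where $d\colon X\times X\to[0,\infty)$ is any function with $d(x,x)=0$ for all $x\in X$ (no symmetry or triangle inequality is assumed). Put $B_d(x,r)=\{z\in X: d(x,z)<r\}$. The topology of $(X,d)$: a set $E\subset X$ is open iff for every $x\in E$ there is $r>0$ with $B_d(x,r)\subset E$. The distance space is well-behaved if $x\in\mathrm{Int}(B_d(x,r))$ for all $x\in X$ and $r>0$. Complete oriented graph. For a set $X$ and distinct $x,y\in X$ the oriented edge is $[x,y]=\{x,y\}\cup\{(x,y,t): t\in(0,1)\}$, where the points $(x,y,t)$ are pairwise distinct for distinct triples and do not belong to $X$; thus $[x,y]\cap[y,x]=\{x,y\}$. Let $\Gamma(X)=X\cup\bigcup\{[x,y]: x,y\in X,\ x\ne y\}$. On pairs of points of a common edge define, for distinct $x,y\in X$ and $t,s\in(0,1)$: $r(x,x)=0$, $r(x,y)=1$, $r((x,y,t),(x,y,s))=|t-s|$, $r(x,(x,y,t))=r((x,y,t),x)=t$, $r(y,(x,y,t))=r((x,y,t),y)=1-t$. For $a,b\in\Gamma(X)$ let $\rho(a,b)$ be the infimum of $\sum_{i=1}^n r(a_i,a_{i-1})$ over all finite sequences $a=a_0,a_1,\dots,a_n=b$ in $\Gamma(X)$ such that any two consecutive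 points lie on a common edge (with $\rho(a,a)=0$). Then $\rho$ is a metric on $\Gamma(X)$ and each edge is isometric to $[0,1]$. Cobweb. Let $(X,d)$ be a distance space and $d_1=\min\{d,1/2\}$. For distinct $a,b\in X$ let $a_b\in[a,b]$ be the unique point with $\rho(a_b,b)=d_1(b,a)$, and let $[a,a_b]=\{z\in[a,b]:\rho(a,z)\le 1-d_1(b,a)\}$. Let $Z_a=\{a\}\cup\bigcup\{[a,a_b]\setminus\{b\}: b\in X\setminus\{a\}\}$. The cobweb over $(X,d)$ is $\mathsf{Cob}(X,d)=\bigcup_{a\in X}Z_a\subset\Gamma(X)$ with the metric $\rho$ restricted from $\Gamma(X)$. The sets $Z_a$ are pairwise disjoint, and the compression map $\pi\colon\mathsf{Cob}(X,d)\to X$ is defined by $\pi(Z_a)=\{a\}$ for all $a\in X$. For topological spaces $X,Y$, a function $f\colon X\to Y$ is: monotone if $f^{-1}(y)$ is connected for each $y\in Y$; quotient if $A\subset Y$ is open in $Y$ whenever $f^{-1}(A)$ is open in $X$; hereditarily quotient if for every open $U\subset X$ and every $y\in Y$, $f^{-1}(y)\subset U$ implies $y\in\mathrm{Int}(f(U))$. *)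

theory Defs
  imports "HOL-Analysis.Analysis"
begin

section \<open>Distance spaces\<close>

locale distance_space =
  fixes X :: "'a set" and d :: "'a \<Rightarrow> 'a \<Rightarrow> real"
  assumes dist_nonneg: "\<And>x y. \<lbrakk>x \<in> X; y \<in> X\<rbrakk> \<Longrightarrow> 0 \<le> d x y"
    and dist_self: "\<And>x. x \<in> X \<Longrightarrow> d x x = 0"

definition dball :: "'a set \<Rightarrow> ('a \<Rightarrow> 'a \<Rightarrow> real) \<Rightarrow> 'a \<Rightarrow> real \<Rightarrow> 'a set" where
  "dball X d x r = {z \<in> X. d x z < r}"

definition dopen :: "'a set \<Rightarrow> ('a \<Rightarrow> 'a \<Rightarrow> real) \<Rightarrow> 'a set \<Rightarrow> bool" where
  "dopen X d E \<longleftrightarrow> E \<subseteq> X \<and> (\<forall>x\<in>E. \<exists>r>0. dball X d x r \<subseteq> E)"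

definition dtopology :: "'a set \<Rightarrow> ('a \<Rightarrow> 'a \<Rightarrow> real) \<Rightarrow> 'a topology" where
  "dtopology X d = topology (dopen X d)"

lemma istopology_dopen: "istopology (dopen X d)"
  unfolding istopology_def
proof (intro conjI allI impI)
  fix S T assume S: "dopen X d S" and T: "dopen X d T"
  show "dopen X d (S \<inter> T)"
    unfolding dopen_def
  proof (intro conjI ballI)
    show "S \<inter> T \<subseteq> X" using S by (auto simp: dopen_def)
  next
    fix x assume "x \<in> S \<inter> T"
    then obtain r s where "r > 0" "dball X d x r \<subseteq> S" "s > 0" "dball X d x s \<subseteq> T"
      using S T unfolding dopen_def by blast
    then show "\<exists>r>0. dball X d x r \<subseteq> S \<inter> T"
      by (intro exI[of _ "min r s"]) (auto simp: dball_def)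
  qed
next
  fix \<K> assume "\<forall>K\<in>\<K>. dopen X d K"
  then show "dopen X d (\<Union>\<K>)"
    unfolding dopen_def by (meson Sup_least UnionE Union_upper order_trans)
qed

lemma openin_dtopology: "openin (dtopology X d) E \<longleftrightarrow> dopen X d E"
  by (simp add: dtopology_def istopology_dopen)

lemma topspace_dtopology [simp]: "topspace (dtopology X d) = X"
proof -
  have "dopen X d X"
    unfolding dopen_def dball_def by (auto intro: exI[of _ 1])
  then show ?thesis
    unfolding topspace_def openin_dtopology by (auto simp: dopen_def)
qed

definition well_behaved :: "'a set \<Rightarrow> ('a \<Rightarrow> 'a \<Rightarrow> real) \<Rightarrow> bool" where
  "well_behaved X d \<longleftrightarrow> (\<forall>x\<in>X. \<forall>r>0. x \<in> dtopology X d interior_of dball X d x r)"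


section \<open>The complete oriented graph\<close>

text \<open>Only the points \<open>Inner x y t\<close> with \<open>x \<noteq> y\<close> and \<open>0 < t < 1\<close> belong to the graph.\<close>

datatype 'a gpoint = Vertex 'a | Inner 'a 'a real

definition edge :: "'a \<Rightarrow> 'a \<Rightarrow> 'a gpoint set" where
  "edge x y = {Vertex x, Vertex y} \<union> {Inner x y t | t. 0 < t \<and> t < 1}"

definition graph :: "'a set \<Rightarrow> 'a gpoint set" where
  "graph X = Vertex ` X \<union> \<Union>{edge x y | x y. x \<in> X \<and> y \<in> X \<and> x \<noteq> y}"

definition common_edge :: "'a set \<Rightarrow> 'a gpoint \<Rightarrow> 'a gpoint \<Rightarrow> bool" where
  "common_edge X a b \<longleftrightarrow> (\<exists>x\<in>X. \<exists>y\<in>X. x \<noteq> y \<and> a \<in> edge x y \<and> b \<in> edge x y)"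

text \<open>The values of \<open>edge_dist\<close> are meaningful only for two points of a common edge; in
  particular the case \<open>v \<noteq> x\<close> below is then the case \<open>v = y\<close>.\<close>

fun edge_dist :: "'a gpoint \<Rightarrow> 'a gpoint \<Rightarrow> real" where
  "edge_dist (Vertex x) (Vertex y) = (if x = y then 0 else 1)"
| "edge_dist (Vertex v) (Inner x y t) = (if v = x then t else 1 - t)"
| "edge_dist (Inner x y t) (Vertex v) = (if v = x then t else 1 - t)"
| "edge_dist (Inner x y t) (Inner x' y' s) = \<bar>t - s\<bar>"

definition chain_lengths :: "'a set \<Rightarrow> 'a gpoint \<Rightarrow> 'a gpoint \<Rightarrow> real set" where
  "chain_lengths X a b =
     {(\<Sum>i=1..n. edge_dist (p i) (p (i - 1))) | (n :: nat) p.
        p 0 = a \<and> p n = b \<and> (\<forall>i\<le>n. p i \<in> graph X) \<and>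
        (\<forall>i\<in>{1..n}. common_edge X (p (i - 1)) (p i))}"

text \<open>Outside the graph \<open>\<rho>\<close> is set to 0, because the locale \<open>Metric_space\<close>
  requires nonnegativity and symmetry on the whole type.\<close>

definition graph_dist :: "'a set \<Rightarrow> 'a gpoint \<Rightarrow> 'a gpoint \<Rightarrow> real" where
  "graph_dist X a b =
     (if a \<in> graph X \<and> b \<in> graph X \<and> a \<noteq> b then Inf (chain_lengths X a b) else 0)"


section \<open>The cobweb\<close>

text \<open>\<open>cob_segment X d a b\<close> is the segment \<open>[a, a\<^sub>b]\<close> of the edge \<open>[a, b]\<close>.\<close>

definition cob_segment :: "'a set \<Rightarrow> ('a \<Rightarrow> 'a \<Rightarrow> real) \<Rightarrow> 'a \<Rightarrow> 'a \<Rightarrow> 'a gpoint set" where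
  "cob_segment X d a b =
     {z \<in> edge a b. graph_dist X (Vertex a) z \<le> 1 - min (d b a) (1/2)}"

definition cob_fibre :: "'a set \<Rightarrow> ('a \<Rightarrow> 'a \<Rightarrow> real) \<Rightarrow> 'a \<Rightarrow> 'a gpoint set" where
  "cob_fibre X d a = {Vertex a} \<union> (\<Union>b\<in>X - {a}. cob_segment X d a b - {Vertex b})"

definition cobweb :: "'a set \<Rightarrow> ('a \<Rightarrow> 'a \<Rightarrow> real) \<Rightarrow> 'a gpoint set" where
  "cobweb X d = (\<Union>a\<in>X. cob_fibre X d a)"

definition cob_topology :: "'a set \<Rightarrow> ('a \<Rightarrow> 'a \<Rightarrow> real) \<Rightarrow> 'a gpoint topology" where
  "cob_topology X d = Metric_space.mtopology (cobweb X d) (graph_dist X)"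

definition compression :: "'a set \<Rightarrow> ('a \<Rightarrow> 'a \<Rightarrow> real) \<Rightarrow> 'a gpoint \<Rightarrow> 'a" where
  "compression X d z = (THE a. a \<in> X \<and> z \<in> cob_fibre X d a)"


section \<open>Hereditarily quotient maps\<close>

definition hereditarily_quotient_map :: "'a topology \<Rightarrow> 'b topology \<Rightarrow> ('a \<Rightarrow> 'b) \<Rightarrow> bool" where
  "hereditarily_quotient_map T S f \<longleftrightarrow>
     (\<forall>U y. openin T U \<and> y \<in> topspace S \<and> {x \<in> topspace T. f x = y} \<subseteq> U
        \<longrightarrow> y \<in> S interior_of (f ` U))"


section \<open>Well-definedness of the metric and of the compression map\<close>

lemma cob_fibre_cases:
  assumes "z \<in> cob_fibre X d a"
  shows "z = Vertex a \<or> (\<exists>b t. z = Inner a b t \<and> b \<in> X \<and> b \<noteq> a \<and> 0 < t \<and> t < 1)"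
  using assms unfolding cob_fibre_def cob_segment_def edge_def by auto

lemma cob_fibre_disjoint:
  assumes "z \<in> cob_fibre X d a" "z \<in> cob_fibre X d b"
  shows "a = b"
  using cob_fibre_cases[OF assms(1)] cob_fibre_cases[OF assms(2)] by auto

lemma compression_eq:
  assumes "a \<in> X" "z \<in> cob_fibre X d a"
  shows "compression X d z = a"
  unfolding compression_def
proof (rule the_equality)
  show "a \<in> X \<and> z \<in> cob_fibre X d a" using assms by simp
  show "b = a" if "b \<in> X \<and> z \<in> cob_fibre X d b" for b
    using that assms(2) cob_fibre_disjoint[of z X d b a] by simp
qed

lemma cobweb_subset_graph: "cobweb X d \<subseteq> graph X"
proof
  fix z assume "z \<in> cobweb X d"
  then obtain a where "a \<in> X" "z \<in> cob_fibre X d a" by (auto simp: cobweb_def)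
  from cob_fibre_cases[OF \<open>z \<in> cob_fibre X d a\<close>] show "z \<in> graph X"
  proof (elim disjE exE conjE)
    assume "z = Vertex a"
    then show ?thesis using \<open>a \<in> X\<close> by (simp add: graph_def)
  next
    fix b t assume "z = Inner a b t" "b \<in> X" "b \<noteq> a" "0 < t" "t < 1"
    then have "z \<in> edge a b" by (simp add: edge_def)
    then show ?thesis
      using \<open>a \<in> X\<close> \<open>b \<in> X\<close> \<open>b \<noteq> a\<close> unfolding graph_def by blast
  qed
qed

lemma graph_cases:
  assumes "a \<in> graph X"
  obtains x where "x \<in> X" "a = Vertex x"
  | x y t where "x \<in> X" "y \<in> X" "x \<noteq> y" "0 < t" "t < 1" "a = Inner x y t"
  using assms unfolding graph_def edge_def by blast

lemma common_edge_sym: "common_edge X a b \<longleftrightarrow> common_edge X b a"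
  unfolding common_edge_def by blast

lemma edge_dist_sym: "edge_dist a b = edge_dist b a"
  by (cases a; cases b) auto

lemma edge_dist_nonneg: "common_edge X a b \<Longrightarrow> 0 \<le> edge_dist a b"
  unfolding common_edge_def edge_def by auto

lemma common_edge_graph: "common_edge X a b \<Longrightarrow> a \<in> graph X \<and> b \<in> graph X"
  unfolding common_edge_def graph_def by blast

lemma chain_lengths_nonneg: "s \<in> chain_lengths X a b \<Longrightarrow> 0 \<le> s"
  unfolding chain_lengths_def
proof (elim CollectE exE conjE)
  fix n :: nat and p
  assume s: "s = (\<Sum>i=1..n. edge_dist (p i) (p (i - 1)))"
    and e: "\<forall>i\<in>{1..n}. common_edge X (p (i - 1)) (p i)"
  have "0 \<le> edge_dist (p i) (p (i - 1))" if "i \<in> {1..n}" for i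
    using edge_dist_nonneg bspec[OF e that] edge_dist_sym[of "p i" "p (i - 1)"] by metis
  then show "0 \<le> s" unfolding s by (rule sum_nonneg)
qed

lemma bdd_below_chain_lengths: "bdd_below (chain_lengths X a b)"
  using chain_lengths_nonneg by (meson bdd_belowI)

lemma chain_lengths_refl: "a \<in> graph X \<Longrightarrow> 0 \<in> chain_lengths X a a"
  unfolding chain_lengths_def
  by (rule CollectI, rule exI[of _ 0], rule exI[of _ "\<lambda>_. a"]) simp

lemma chain_lengths_step:
  assumes "s \<in> chain_lengths X a b" "common_edge X b c"
  shows "s + edge_dist c b \<in> chain_lengths X a c"
proof -
  obtain n :: nat and p where p: "s = (\<Sum>i=1..n. edge_dist (p i) (p (i - 1)))" "p 0 = a" "p n = b"
      "\<forall>i\<le>n. p i \<in> graph X" "\<forall>i\<in>{1..n}. common_edge X (p (i - 1)) (p i)"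
    using assms(1) unfolding chain_lengths_def by blast
  define q where "q i = (if i \<le> n then p i else c)" for i
  have "(\<Sum>i=1..n. edge_dist (q i) (q (i - 1))) = s"
    unfolding p(1) by (rule sum.cong) (auto simp: q_def)
  then have "(\<Sum>i=1..Suc n. edge_dist (q i) (q (i - 1))) = s + edge_dist c b"
    using p by (simp add: q_def)
  moreover have "q 0 = a" "q (Suc n) = c" using p by (auto simp: q_def)
  moreover have "\<forall>i\<le>Suc n. q i \<in> graph X"
    using p common_edge_graph[OF assms(2)] by (auto simp: q_def)
  moreover have "\<forall>i\<in>{1..Suc n}. common_edge X (q (i - 1)) (q i)"
  proof
    fix i assume "i \<in> {1..Suc n}"
    then show "common_edge X (q (i - 1)) (q i)"
      using p assms(2) by (cases "i = Suc n") (auto simp: q_def)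
  qed
  ultimately show ?thesis unfolding chain_lengths_def
    by (intro CollectI exI[of _ "Suc n"] exI[of _ q] conjI) (simp_all only:)
qed

lemma chain_lengths_induct [consumes 1, case_names refl step]:
  assumes "s \<in> chain_lengths X a b"
    and refl: "a \<in> graph X \<Longrightarrow> P a 0"
    and step: "\<And>b c s. \<lbrakk>s \<in> chain_lengths X a b; P b s; common_edge X b c\<rbrakk>
                 \<Longrightarrow> P c (s + edge_dist c b)"
  shows "P b s"
proof -
  obtain n :: nat and p where p: "s = (\<Sum>i=1..n. edge_dist (p i) (p (i - 1)))" "p 0 = a" "p n = b"
      "\<forall>i\<le>n. p i \<in> graph X" "\<forall>i\<in>{1..n}. common_edge X (p (i - 1)) (p i)"
    using assms(1) unfolding chain_lengths_def by blast
  have "m \<le> n \<Longrightarrow> (\<Sum>i=1..m. edge_dist (p i) (p (i - 1))) \<in> chain_lengths X a (p m) \<and>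
      P (p m) (\<Sum>i=1..m. edge_dist (p i) (p (i - 1)))" for m
  proof (induction m)
    case 0
    then show ?case using p refl chain_lengths_refl by auto
  next
    case (Suc m)
    have e: "common_edge X (p m) (p (Suc m))"
      using bspec[OF p(5), of "Suc m"] Suc.prems by simp
    from Suc show ?case
      using chain_lengths_step[OF _ e] step[OF _ _ e] by simp
  qed
  from this[of n] show ?thesis using p by simp
qed

lemma chain_lengths_trans:
  assumes "t \<in> chain_lengths X b c" "s \<in> chain_lengths X a b"
  shows "s + t \<in> chain_lengths X a c"
  using assms
proof (induction rule: chain_lengths_induct)
  case refl
  then show ?case by simp
next
  case (step c c' t)
  then show ?case using chain_lengths_step[of "s + t" X a c c'] by (simp add: add.assoc)
qed

lemma chain_lengths_edge:
  assumes "common_edge X a b"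
  shows "edge_dist a b \<in> chain_lengths X a b"
  using chain_lengths_step[OF chain_lengths_refl assms] common_edge_graph[OF assms]
  by (simp add: edge_dist_sym)

lemma chain_lengths_sym:
  assumes "s \<in> chain_lengths X a b"
  shows "s \<in> chain_lengths X b a"
  using assms
proof (induction rule: chain_lengths_induct)
  case refl
  then show ?case by (rule chain_lengths_refl)
next
  case (step b c s)
  have "edge_dist c b \<in> chain_lengths X c b"
    using chain_lengths_edge common_edge_sym step by metis
  then show ?case
    using chain_lengths_trans[OF \<open>s \<in> chain_lengths X b a\<close>] by (metis add.commute)
qed

lemma chain_lengths_nonempty:
  assumes "a \<in> graph X" "b \<in> graph X"
  shows "chain_lengths X a b \<noteq> {}"
proof -
  have vv: "chain_lengths X (Vertex x) (Vertex y) \<noteq> {}" if "x \<in> X" "y \<in> X" for x y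
  proof (cases "x = y")
    case True
    have "Vertex x \<in> graph X" using that by (auto simp: graph_def)
    with True show ?thesis using chain_lengths_refl by blast
  next
    case False
    then have "common_edge X (Vertex x) (Vertex y)"
      using that by (auto simp: common_edge_def edge_def)
    then show ?thesis using chain_lengths_edge by blast
  qed
  have v: "\<exists>x\<in>X. chain_lengths X a (Vertex x) \<noteq> {}" if "a \<in> graph X" for a
    using that
  proof (cases rule: graph_cases)
    case (1 x)
    then show ?thesis using vv by blast
  next
    case (2 x y t)
    then have "common_edge X a (Vertex x)"
      unfolding common_edge_def edge_def by blast
    with 2 show ?thesis using chain_lengths_edge by blast
  qed
  from v[OF assms(1)] v[OF assms(2)] vv show ?thesis
    by (metis chain_lengths_sym chain_lengths_trans ex_in_conv)
qed

lemma chain_lengths_lipschitz: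
  assumes "s \<in> chain_lengths X a b"
    and "\<And>u v. common_edge X u v \<Longrightarrow> f v - f u \<le> edge_dist v u"
  shows "f b - f a \<le> s"
  using assms(1)
proof (induction rule: chain_lengths_induct)
  case refl
  then show ?case by simp
next
  case (step b c s)
  then show ?case using assms(2)[of b c] by simp
qed

lemma graph_separation:
  assumes "a \<in> graph X" "b \<in> graph X" "a \<noteq> b"
  shows "\<exists>e>0. \<forall>s\<in>chain_lengths X a b. e \<le> s"
  using assms(1)
proof (cases rule: graph_cases)
  case (1 x)
  define f where "f z = (case z of Vertex y \<Rightarrow> if y = x then 0 else 1
      | Inner y y' t \<Rightarrow> if y = x then t else if y' = x then 1 - t else (1::real))" for z
  have "f v - f u \<le> edge_dist v u" if "common_edge X u v" for u v
    using that unfolding common_edge_def edge_def by (auto simp: f_def)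
  then have "\<forall>s\<in>chain_lengths X a b. f b - f a \<le> s"
    using chain_lengths_lipschitz by metis
  moreover have "f a = 0" using 1 by (simp add: f_def)
  moreover have "f b > 0"
    using assms(2) by (cases rule: graph_cases) (use 1 assms(3) in \<open>auto simp: f_def\<close>)
  ultimately show ?thesis by auto
next
  case (2 x y t)
  define m where "m = min t (1 - t)"
  define f where "f z = (case z of Vertex _ \<Rightarrow> m
      | Inner x' y' s \<Rightarrow> if x' = x \<and> y' = y then min \<bar>t - s\<bar> m else m)" for z
  have "f v - f u \<le> edge_dist v u" if "common_edge X u v" for u v
    using that 2 unfolding common_edge_def edge_def by (auto simp: f_def m_def)
  then have "\<forall>s\<in>chain_lengths X a b. f b - f a \<le> s"
    using chain_lengths_lipschitz by metis
  moreover have "f a = 0" using 2 by (simp add: f_def m_def)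
  moreover have "f b > 0"
    using assms(2) by (cases rule: graph_cases) (use 2 assms(3) in \<open>auto simp: f_def m_def\<close>)
  ultimately show ?thesis by auto
qed

lemma graph_dist_le:
  "\<lbrakk>a \<in> graph X; b \<in> graph X; s \<in> chain_lengths X a b\<rbrakk> \<Longrightarrow> graph_dist X a b \<le> s"
  unfolding graph_dist_def
  by (auto intro: cInf_lower bdd_below_chain_lengths chain_lengths_nonneg)

lemma graph_dist_approx:
  assumes "a \<in> graph X" "b \<in> graph X" "e > 0"
  shows "\<exists>s\<in>chain_lengths X a b. s < graph_dist X a b + e"
proof (cases "a = b")
  case True
  then show ?thesis
    using assms chain_lengths_refl by (auto simp: graph_dist_def intro!: bexI[of _ 0])
next
  case False
  then show ?thesis
    using assms cInf_lessD[OF chain_lengths_nonempty[OF assms(1,2)],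
        of "Inf (chain_lengths X a b) + e"] by (auto simp: graph_dist_def)
qed

lemma Metric_space_graph: "Metric_space (graph X) (graph_dist X)"
proof
  fix a b c :: "'a gpoint"
  show "0 \<le> graph_dist X a b"
    using cInf_greatest[of "chain_lengths X a b" 0] chain_lengths_nonempty[of a X b]
      chain_lengths_nonneg[of _ X a b] by (auto simp: graph_dist_def)
  have "chain_lengths X a b = chain_lengths X b a"
    using chain_lengths_sym by blast
  then show "graph_dist X a b = graph_dist X b a"
    unfolding graph_dist_def by auto
  show "graph_dist X a b = 0 \<longleftrightarrow> a = b" if "a \<in> graph X" "b \<in> graph X"
  proof (cases "a = b")
    case True
    then show ?thesis by (simp add: graph_dist_def)
  next
    case False
    obtain e where "e > 0" "\<forall>s\<in>chain_lengths X a b. e \<le> s"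
      using graph_separation[OF \<open>a \<in> graph X\<close> \<open>b \<in> graph X\<close> False] by blast
    then have "e \<le> Inf (chain_lengths X a b)"
      by (intro cInf_greatest chain_lengths_nonempty that) auto
    with \<open>e > 0\<close> False that show ?thesis by (simp add: graph_dist_def)
  qed
  show "graph_dist X a c \<le> graph_dist X a b + graph_dist X b c"
    if abc: "a \<in> graph X" "b \<in> graph X" "c \<in> graph X"
  proof (rule field_le_epsilon)
    fix e :: real assume "e > 0"
    then have "e/2 > 0" by simp
    obtain s where s: "s \<in> chain_lengths X a b" "s < graph_dist X a b + e/2"
      using graph_dist_approx[OF abc(1,2) \<open>e/2 > 0\<close>] by blast
    obtain t where t: "t \<in> chain_lengths X b c" "t < graph_dist X b c + e/2"
      using graph_dist_approx[OF abc(2,3) \<open>e/2 > 0\<close>] by blast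
    have "graph_dist X a c \<le> s + t"
      by (rule graph_dist_le[OF abc(1,3) chain_lengths_trans[OF t(1) s(1)]])
    with s t show "graph_dist X a c \<le> graph_dist X a b + graph_dist X b c + e" by simp
  qed
qed

lemma Metric_space_cobweb: "Metric_space (cobweb X d) (graph_dist X)"
  using Metric_space_graph cobweb_subset_graph by (rule Metric_space.subspace)

lemma topspace_cob_topology [simp]: "topspace (cob_topology X d) = cobweb X d"
  unfolding cob_topology_def by (rule Metric_space.topspace_mtopology[OF Metric_space_cobweb])

end

theory Submission
  imports Defs
begin

text \<open>
  Everything rests on one local computation. For \<open>r \<le> 1/2\<close> the ball of radius \<open>r\<close> around the
  vertex \<open>b\<close> of the graph consists of short initial pieces of the edges leaving \<open>b\<close> and short
  final pieces of the edges arriving at \<open>b\<close>. In the cobweb the initial pieces belong to the fibre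
  of \<open>b\<close>, while the edge arriving from \<open>a\<close> belongs to the fibre of \<open>a\<close> and has been cut at
  distance \<open>min (d b a) (1/2)\<close> from \<open>b\<close>. Hence the ball meets the fibre of \<open>a\<close> exactly when
  \<open>d b a < r\<close>, and the compression map sends it onto the ball \<open>dball X d b r\<close>
  (\<open>compression_vertex_ball\<close>). Around an inner point of an edge nothing happens: a small ball
  stays inside that edge (\<open>inner_ball\<close>), so the compression map is locally constant there.

  The claims are read off from this. A set \<open>A\<close> of points of \<open>X\<close> is open iff it contains a
  \<open>d\<close>-ball around each of its points, and by the computation this says that the preimage of \<open>A\<close>
  contains a \<open>\<rho>\<close>-ball around each of its vertices; at inner points this is automatic. So the map is
  continuous and quotient. Each fibre is a star of segments issuing from its vertex, hence
  connected, and a monotone quotient map reflects connectedness. Finally, every open set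
  containing the fibre of \<open>y\<close> has an image containing a ball around \<open>y\<close>; conversely, the fibre of
  \<open>y\<close> has open neighbourhoods whose image is exactly an arbitrarily small ball around \<open>y\<close>
  (\<open>fibre_neighbourhood\<close>). Therefore the condition in the definition of a hereditarily quotient
  map says that small balls around \<open>y\<close> are neighbourhoods of \<open>y\<close>.

  Upper bounds for \<open>\<rho>\<close> come from single edges, and lower bounds from functions
  on the graph that are 1-Lipschitz along each edge.
\<close>

section \<open>Estimates for the graph metric\<close>

lemma graph_dist_le_edge_dist:
  assumes "common_edge X a b"
  shows "graph_dist X a b \<le> edge_dist a b"
  using graph_dist_le[OF _ _ chain_lengths_edge[OF assms]] common_edge_graph[OF assms] by blast

lemma graph_dist_lower_bound:
  assumes "a \<in> graph X" "b \<in> graph X"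
    and "\<And>u v. common_edge X u v \<Longrightarrow> f v - f u \<le> edge_dist v u"
  shows "f b - f a \<le> graph_dist X a b"
proof (cases "a = b")
  case False
  have "f b - f a \<le> Inf (chain_lengths X a b)"
    using chain_lengths_lipschitz[of _ X a b f] assms
    by (intro cInf_greatest chain_lengths_nonempty) auto
  with False assms show ?thesis by (simp add: graph_dist_def)
qed (simp add: graph_dist_def)

text \<open>The function \<open>min 1 (\<rho> (Vertex x) _)\<close>, written out so that its Lipschitz property can be
  checked edge by edge.\<close>

fun vertex_gap :: "'a \<Rightarrow> 'a gpoint \<Rightarrow> real" where
  "vertex_gap x (Vertex y) = (if y = x then 0 else 1)"
| "vertex_gap x (Inner y y' t) = (if y = x then t else if y' = x then 1 - t else 1)"

lemma vertex_gap_le_graph_dist: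
  assumes "x \<in> X" "z \<in> graph X"
  shows "vertex_gap x z \<le> graph_dist X (Vertex x) z"
proof -
  have "vertex_gap x v - vertex_gap x u \<le> edge_dist v u" if "common_edge X u v" for u v
    using that unfolding common_edge_def edge_def by auto
  moreover have "Vertex x \<in> graph X" using assms by (simp add: graph_def)
  ultimately show ?thesis
    using graph_dist_lower_bound[of "Vertex x" X z "vertex_gap x"] assms by simp
qed

lemma graph_dist_vertex_inner:
  assumes "a \<in> X" "b \<in> X" "a \<noteq> b" "0 < t" "t < 1"
  shows "graph_dist X (Vertex a) (Inner a b t) = t"
    and "graph_dist X (Vertex b) (Inner a b t) = 1 - t"
proof -
  have *: "common_edge X (Vertex a) (Inner a b t)" "common_edge X (Vertex b) (Inner a b t)"
    using assms by (auto simp: common_edge_def edge_def)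
  note lower = vertex_gap_le_graph_dist[OF _ common_edge_graph[OF *(1), THEN conjunct2]]
  show "graph_dist X (Vertex a) (Inner a b t) = t"
    using graph_dist_le_edge_dist[OF *(1)] lower[of a] assms by simp
  show "graph_dist X (Vertex b) (Inner a b t) = 1 - t"
    using graph_dist_le_edge_dist[OF *(2)] lower[of b] assms by simp
qed

text \<open>A chain leaving the open edge from \<open>a\<close> to \<open>b\<close> passes through one of its endpoints, so it
  has length at least \<open>m = min t (1 - t)\<close>. The Lipschitz function recording this is the distance
  to \<open>Inner a b t\<close>, cut off at \<open>m\<close>.\<close>

lemma inner_ball:
  assumes "Inner a b t \<in> graph X" "z \<in> graph X"
    and "graph_dist X (Inner a b t) z < min t (1 - t)"
  shows "\<exists>s. z = Inner a b s"
proof (rule ccontr)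
  assume z: "\<nexists>s. z = Inner a b s"
  define m where "m = min t (1 - t)"
  define f where "f w = (case w of Vertex _ \<Rightarrow> m
      | Inner x y s \<Rightarrow> if x = a \<and> y = b then min \<bar>t - s\<bar> m else m)" for w
  have t: "0 < t" "t < 1" using assms(1) by (auto elim: graph_cases)
  have "f v - f u \<le> edge_dist v u" if "common_edge X u v" for u v
    using that t unfolding common_edge_def edge_def by (auto simp: f_def m_def)
  then have "f z - f (Inner a b t) \<le> graph_dist X (Inner a b t) z"
    by (rule graph_dist_lower_bound[OF assms(1,2)])
  moreover have "f (Inner a b t) = 0" using t by (simp add: f_def m_def)
  moreover have "f z = m" using z by (cases z) (auto simp: f_def)
  ultimately show False using assms(3) by (simp add: m_def)
qed

section \<open>Points and open sets of the cobweb\<close>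

lemma Vertex_in_fibre: "Vertex a \<in> cob_fibre X d a"
  by (simp add: cob_fibre_def)

lemma Vertex_in_cobweb [simp]: "Vertex a \<in> cobweb X d \<longleftrightarrow> a \<in> X"
  using cob_fibre_cases Vertex_in_fibre unfolding cobweb_def by fastforce

lemma Inner_in_fibre:
  assumes "a \<in> X"
  shows "Inner a b t \<in> cob_fibre X d a \<longleftrightarrow>
    b \<in> X \<and> b \<noteq> a \<and> 0 < t \<and> t < 1 \<and> t \<le> 1 - min (d b a) (1/2)"
proof
  assume L: "Inner a b t \<in> cob_fibre X d a"
  then have *: "b \<in> X" "b \<noteq> a" "0 < t" "t < 1"
    using cob_fibre_cases[OF L] by auto
  with L have "graph_dist X (Vertex a) (Inner a b t) \<le> 1 - min (d b a) (1/2)"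
    unfolding cob_fibre_def cob_segment_def edge_def by auto
  with * assms show "b \<in> X \<and> b \<noteq> a \<and> 0 < t \<and> t < 1 \<and> t \<le> 1 - min (d b a) (1/2)"
    using graph_dist_vertex_inner(1)[of a X b t] by simp
next
  assume R: "b \<in> X \<and> b \<noteq> a \<and> 0 < t \<and> t < 1 \<and> t \<le> 1 - min (d b a) (1/2)"
  then have "Inner a b t \<in> cob_segment X d a b - {Vertex b}"
    using graph_dist_vertex_inner(1)[of a X b t] assms
    by (auto simp: cob_segment_def edge_def)
  with R show "Inner a b t \<in> cob_fibre X d a" by (auto simp: cob_fibre_def)
qed

lemma Inner_in_cobweb:
  "Inner a b t \<in> cobweb X d \<longleftrightarrow>
    a \<in> X \<and> b \<in> X \<and> b \<noteq> a \<and> 0 < t \<and> t < 1 \<and> t \<le> 1 - min (d b a) (1/2)"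
proof -
  have "Inner a b t \<in> cobweb X d \<longleftrightarrow> a \<in> X \<and> Inner a b t \<in> cob_fibre X d a"
    using cob_fibre_cases[of "Inner a b t" X d] unfolding cobweb_def by blast
  then show ?thesis using Inner_in_fibre[of a X b t d] by blast
qed

lemma compression_Vertex [simp]: "a \<in> X \<Longrightarrow> compression X d (Vertex a) = a"
  by (rule compression_eq[OF _ Vertex_in_fibre])

lemma compression_Inner [simp]:
  "Inner a b t \<in> cobweb X d \<Longrightarrow> compression X d (Inner a b t) = a"
  by (rule compression_eq) (auto simp: Inner_in_cobweb Inner_in_fibre)

lemma compression_in: "z \<in> cobweb X d \<Longrightarrow> compression X d z \<in> X"
  unfolding cobweb_def using compression_eq by fastforce

lemma compression_fibre:
  "a \<in> X \<Longrightarrow> {z \<in> cobweb X d. compression X d z = a} = cob_fibre X d a"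
  unfolding cobweb_def using compression_eq by fastforce

lemma compression_surj: "compression X d ` cobweb X d = X"
proof
  show "X \<subseteq> compression X d ` cobweb X d"
    using Vertex_in_cobweb compression_Vertex by (metis image_eqI subsetI)
qed (use compression_in in blast)

lemma openin_cob_topology:
  "openin (cob_topology X d) U \<longleftrightarrow> U \<subseteq> cobweb X d \<and>
     (\<forall>z\<in>U. \<exists>r>0. \<forall>w\<in>cobweb X d. graph_dist X z w < r \<longrightarrow> w \<in> U)"
proof -
  interpret M: Metric_space "cobweb X d" "graph_dist X" by (rule Metric_space_cobweb)
  show ?thesis
    unfolding cob_topology_def M.openin_mtopology M.mball_def by blast
qed

lemma openin_vertex_ball:
  assumes "b \<in> X"
  shows "openin (cob_topology X d) {z \<in> cobweb X d. graph_dist X (Vertex b) z < r}"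
proof -
  interpret M: Metric_space "cobweb X d" "graph_dist X" by (rule Metric_space_cobweb)
  have "{z \<in> cobweb X d. graph_dist X (Vertex b) z < r} = M.mball (Vertex b) r"
    using assms by (auto simp: M.mball_def)
  then show ?thesis by (simp add: cob_topology_def)
qed

lemma compression_locally_constant:
  assumes z: "Inner a b t \<in> cobweb X d"
  shows "\<exists>r>0. \<forall>w\<in>cobweb X d. graph_dist X (Inner a b t) w < r \<longrightarrow> (\<exists>s. w = Inner a b s)"
proof (rule exI[of _ "min t (1 - t)"], intro conjI ballI impI)
  show "0 < min t (1 - t)" using z by (simp add: Inner_in_cobweb)
  fix w assume "w \<in> cobweb X d" and lt: "graph_dist X (Inner a b t) w < min t (1 - t)"
  then have "Inner a b t \<in> graph X" "w \<in> graph X" using z cobweb_subset_graph by blast+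
  from inner_ball[OF this lt] show "\<exists>s. w = Inner a b s" .
qed

section \<open>Vertex balls compress to distance balls\<close>

text \<open>The cut-off \<open>1/2\<close> in the segments of the cobweb is invisible at radii up to \<open>1/2\<close>: a point
  of the edge from \<open>a\<close> to \<open>b\<close> at distance less than \<open>r\<close> from \<open>b\<close> is left in the cobweb iff
  \<open>min (d b a) (1/2) < r\<close>, that is, iff \<open>d b a < r\<close>.\<close>

lemma compression_vertex_ball:
  assumes "distance_space X d" and b: "b \<in> X" and r: "0 < r" "r \<le> 1/2"
  shows "compression X d ` {z \<in> cobweb X d. graph_dist X (Vertex b) z < r} = dball X d b r"
    (is "?L = ?R")
proof
  interpret distance_space X d by fact
  show "?L \<subseteq> ?R"
  proof clarify
    fix z assume z: "z \<in> cobweb X d" and lt: "graph_dist X (Vertex b) z < r"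
    have gap: "vertex_gap b z < r"
      using vertex_gap_le_graph_dist[OF b, of z] z cobweb_subset_graph lt by fastforce
    show "compression X d z \<in> dball X d b r"
    proof (cases z)
      case (Vertex a)
      with gap r b show ?thesis by (auto simp: dball_def dist_self split: if_splits)
    next
      case (Inner a c t)
      note cob = z[unfolded Inner Inner_in_cobweb]
      have "d b a < r"
        using gap r cob dist_self[OF b] by (auto simp: Inner split: if_splits)
      with z Inner cob show ?thesis by (simp add: dball_def)
    qed
  qed
  show "?R \<subseteq> ?L"
  proof
    fix a assume "a \<in> ?R"
    then have a: "a \<in> X" "d b a < r" by (auto simp: dball_def)
    have db: "0 \<le> d b a" using a b by (intro dist_nonneg)
    show "a \<in> ?L"
    proof (cases "a = b")
      case True
      with b r show ?thesis
        by (intro image_eqI[of _ _ "Vertex b"]) (auto simp: graph_dist_def)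
    next
      case False
      \<comment> \<open>a point strictly nearer to \<open>b\<close> than \<open>r\<close>, but different from \<open>b\<close> even if \<open>d b a = 0\<close>\<close>
      define s where "s = (d b a + r) / 2"
      have s: "0 < s" "s < 1" "s < r" "d b a \<le> s" using a db r by (auto simp: s_def)
      have in_cob: "Inner a b (1 - s) \<in> cobweb X d"
        using a b s False by (auto simp: Inner_in_cobweb)
      moreover have "graph_dist X (Vertex b) (Inner a b (1 - s)) < r"
        using graph_dist_vertex_inner(2)[of a X b "1 - s"] a b s False by simp
      ultimately show ?thesis
        by (intro image_eqI[of _ _ "Inner a b (1 - s)"]) auto
    qed
  qed
qed

lemma ball_in_compression_image:
  assumes ds: "distance_space X d" and U: "openin (cob_topology X d) U" and "Vertex b \<in> U"
  shows "\<exists>r>0. dball X d b r \<subseteq> compression X d ` U"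
proof -
  have b: "b \<in> X" using openin_subset[OF U] assms(3) by auto
  obtain r where r: "r > 0" "\<And>w. w \<in> cobweb X d \<Longrightarrow> graph_dist X (Vertex b) w < r \<Longrightarrow> w \<in> U"
    using U assms(3) unfolding openin_cob_topology by metis
  have "dball X d b (min r (1/2)) =
      compression X d ` {z \<in> cobweb X d. graph_dist X (Vertex b) z < min r (1/2)}"
    using r b by (intro compression_vertex_ball[OF ds, symmetric]) auto
  also have "\<dots> \<subseteq> compression X d ` U" using r by auto
  finally show ?thesis using r(1) by (intro exI[of _ "min r (1/2)"]) auto
qed

section \<open>The compression map as a quotient map\<close>

text \<open>The implication from right to left is continuity, the other one is the quotient property.
  In both, only the vertices matter: at inner points the preimage of any set contains a ball.\<close>

lemma openin_compression_preimage:
  assumes ds: "distance_space X d" and A: "A \<subseteq> X"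
  shows "openin (cob_topology X d) {z \<in> cobweb X d. compression X d z \<in> A} \<longleftrightarrow>
    openin (dtopology X d) A" (is "openin _ ?P \<longleftrightarrow> _")
proof
  assume P: "openin (cob_topology X d) ?P"
  have "\<exists>r>0. dball X d x r \<subseteq> A" if "x \<in> A" for x
  proof -
    have "Vertex x \<in> ?P" using that A by auto
    then obtain r where "r > 0" "dball X d x r \<subseteq> compression X d ` ?P"
      using ball_in_compression_image[OF ds P] by blast
    then show ?thesis by blast
  qed
  with A show "openin (dtopology X d) A" by (simp add: openin_dtopology dopen_def)
next
  assume "openin (dtopology X d) A"
  then have ball: "\<exists>r>0. dball X d x r \<subseteq> A" if "x \<in> A" for x
    using that by (simp add: openin_dtopology dopen_def)
  have "\<exists>r>0. \<forall>w\<in>cobweb X d. graph_dist X z w < r \<longrightarrow> w \<in> ?P" if z: "z \<in> ?P" for z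
  proof (cases z)
    case (Vertex b)
    with z have b: "b \<in> X" "b \<in> A" by auto
    obtain r where r: "r > 0" "dball X d b r \<subseteq> A" using ball[OF b(2)] by blast
    define r' where "r' = min r (1/2)"
    have "compression X d ` {w \<in> cobweb X d. graph_dist X z w < r'} = dball X d b r'"
      unfolding Vertex using r b by (intro compression_vertex_ball[OF ds]) (auto simp: r'_def)
    also have "\<dots> \<subseteq> A" using r(2) by (auto simp: r'_def dball_def)
    finally show ?thesis using r(1) by (intro exI[of _ r']) (auto simp: r'_def)
  next
    case (Inner a b t)
    with z have "Inner a b t \<in> cobweb X d" "a \<in> A" by auto
    with compression_locally_constant[OF this(1)] show ?thesis
      unfolding Inner by fastforce
  qed
  then show "openin (cob_topology X d) ?P" unfolding openin_cob_topology by blast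
qed

lemma quotient_map_compression:
  "distance_space X d \<Longrightarrow> quotient_map (cob_topology X d) (dtopology X d) (compression X d)"
  unfolding quotient_map_def by (simp add: compression_surj openin_compression_preimage)

section \<open>Connectedness of the fibres\<close>

lemma connectedin_initial_segment:
  fixes a b :: 'a
  defines "g \<equiv> \<lambda>u. if u = 0 then Vertex a else Inner a b u"
  assumes z: "Inner a b t \<in> cobweb X d"
  shows "connectedin (cob_topology X d) (g ` {0..t})" and "g ` {0..t} \<subseteq> cob_fibre X d a"
proof -
  interpret M: Metric_space "cobweb X d" "graph_dist X" by (rule Metric_space_cobweb)
  note cob = z[unfolded Inner_in_cobweb]
  show fib: "g ` {0..t} \<subseteq> cob_fibre X d a"
    using cob Vertex_in_fibre[of a X d] by (auto simp: g_def Inner_in_fibre)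
  have gX: "g u \<in> cobweb X d" if "u \<in> {0..t}" for u
    using fib that cob unfolding cobweb_def by blast
  have dist: "graph_dist X (g u) (g v) \<le> \<bar>u - v\<bar>" if "u \<in> {0..t}" "v \<in> {0..t}" for u v
  proof -
    have edge: "g w \<in> edge a b" if "w \<in> {0..t}" for w
      using that cob by (auto simp: g_def edge_def)
    have "common_edge X (g u) (g v)"
      unfolding common_edge_def
      by (rule bexI[of _ a], rule bexI[of _ b]) (use edge that cob in auto)
    from graph_dist_le_edge_dist[OF this] that show ?thesis
      by (auto simp: g_def split: if_splits)
  qed
  have "continuous_map (top_of_set {0..t}) M.mtopology g"
    unfolding M.continuous_map_to_metric
  proof (intro ballI allI impI)
    fix u e :: real assume u: "u \<in> topspace (top_of_set {0..t})" and "e > 0"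
    have "g v \<in> M.mball (g u) e" if "v \<in> {0..t} \<inter> ball u e" for v
      using that u dist[of u v] gX by (auto simp: dist_real_def)
    moreover have "openin (top_of_set {0..t}) ({0..t} \<inter> ball u e)"
      by (intro openin_open_Int) simp
    ultimately show "\<exists>U. openin (top_of_set {0..t}) U \<and> u \<in> U \<and> (\<forall>v\<in>U. g v \<in> M.mball (g u) e)"
      using u \<open>e > 0\<close> by (intro exI[of _ "{0..t} \<inter> ball u e"]) simp
  qed
  moreover have "connectedin (top_of_set {0..t}) {0..t}" by simp
  ultimately show "connectedin (cob_topology X d) (g ` {0..t})"
    unfolding cob_topology_def by (rule connectedin_continuous_map_image)
qed

text \<open>A fibre is a star: it is the union of initial segments of edges, all issuing from its
  vertex.\<close>

lemma connectedin_cob_fibre: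
  assumes a: "a \<in> X"
  shows "connectedin (cob_topology X d) (cob_fibre X d a)"
proof -
  let ?\<C> = "{C. connectedin (cob_topology X d) C \<and> Vertex a \<in> C \<and> C \<subseteq> cob_fibre X d a}"
  have "\<exists>C\<in>?\<C>. z \<in> C" if z: "z \<in> cob_fibre X d a" for z
    using cob_fibre_cases[OF z]
  proof (elim disjE exE conjE)
    assume "z = Vertex a"
    with a z have "{z} \<in> ?\<C>" by simp
    then show ?thesis by blast
  next
    fix b t assume zt: "z = Inner a b t" and t: "0 < t"
    let ?S = "(\<lambda>u. if u = 0 then Vertex a else Inner a b u) ` {0..t}"
    have "Inner a b t \<in> cobweb X d" using z zt a unfolding cobweb_def by blast
    note seg = connectedin_initial_segment[OF this]
    have "Vertex a \<in> ?S" using t by (intro image_eqI[of _ _ 0]) auto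
    moreover have "z \<in> ?S" using t zt by (intro image_eqI[of _ _ t]) auto
    ultimately show ?thesis using seg by (intro bexI[of _ ?S]) simp_all
  qed
  then have "\<Union>?\<C> = cob_fibre X d a" by blast
  moreover have "connectedin (cob_topology X d) (\<Union>?\<C>)"
    by (rule connectedin_Union) auto
  ultimately show ?thesis by simp
qed

lemma monotone_map_compression: "monotone_map (cob_topology X d) (dtopology X d) (compression X d)"
  unfolding monotone_map_def
  by (auto simp: compression_fibre connectedin_cob_fibre compression_in)

section \<open>Hereditary quotients and well-behaved distance spaces\<close>

text \<open>The fibre without its vertex is open in the cobweb and is compressed to one point, so adding
  it to a ball around the vertex gives a neighbourhood of the whole fibre with the same image.\<close>

lemma fibre_neighbourhood:
  assumes ds: "distance_space X d" and x: "x \<in> X" and r: "0 < r" "r \<le> 1/2"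
  obtains U where "openin (cob_topology X d) U" "cob_fibre X d x \<subseteq> U"
    "compression X d ` U = dball X d x r"
proof -
  interpret distance_space X d by fact
  define B where "B = {z \<in> cobweb X d. graph_dist X (Vertex x) z < r}"
  define F where "F = {z \<in> cobweb X d. \<exists>b t. z = Inner x b t}"
  have "openin (cob_topology X d) F"
    unfolding openin_cob_topology
  proof (intro conjI ballI)
    show "F \<subseteq> cobweb X d" by (auto simp: F_def)
    fix z assume "z \<in> F"
    then obtain b t where "z = Inner x b t" "Inner x b t \<in> cobweb X d" by (auto simp: F_def)
    with compression_locally_constant[OF this(2)]
    show "\<exists>r>0. \<forall>w\<in>cobweb X d. graph_dist X z w < r \<longrightarrow> w \<in> F"
      by (fastforce simp: F_def)
  qed
  then have "openin (cob_topology X d) (B \<union> F)"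
    unfolding B_def by (intro openin_Un openin_vertex_ball[OF x])
  moreover have "cob_fibre X d x \<subseteq> B \<union> F"
  proof
    fix z assume z: "z \<in> cob_fibre X d x"
    then have zX: "z \<in> cobweb X d" using x by (auto simp: cobweb_def)
    from cob_fibre_cases[OF z] show "z \<in> B \<union> F"
    proof
      assume "z = Vertex x"
      then show ?thesis using zX r by (simp add: B_def graph_dist_def)
    qed (use zX in \<open>auto simp: F_def\<close>)
  qed
  moreover have "compression X d ` (B \<union> F) = dball X d x r"
  proof -
    have "compression X d ` B = dball X d x r"
      unfolding B_def by (rule compression_vertex_ball[OF ds x r])
    moreover have "compression X d ` F \<subseteq> {x}" by (auto simp: F_def)
    moreover have "x \<in> dball X d x r" using x r dist_self by (simp add: dball_def)
    ultimately show ?thesis by auto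
  qed
  ultimately show thesis by (rule that)
qed

lemma hereditarily_quotient_compression_iff:
  assumes ds: "distance_space X d"
  shows "hereditarily_quotient_map (cob_topology X d) (dtopology X d) (compression X d)
    \<longleftrightarrow> well_behaved X d"
proof
  assume H: "hereditarily_quotient_map (cob_topology X d) (dtopology X d) (compression X d)"
  show "well_behaved X d"
    unfolding well_behaved_def
  proof (intro ballI allI impI)
    fix x and r :: real assume x: "x \<in> X" and r: "0 < r"
    have r': "0 < min r (1/2)" "min r (1/2) \<le> 1/2" using r by auto
    obtain U where U: "openin (cob_topology X d) U" "cob_fibre X d x \<subseteq> U"
        "compression X d ` U = dball X d x (min r (1/2))"
      using fibre_neighbourhood[OF ds x r'] .
    have "x \<in> dtopology X d interior_of (compression X d ` U)"
      using H U(1,2) x unfolding hereditarily_quotient_map_def by (simp add: compression_fibre)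
    moreover have "compression X d ` U \<subseteq> dball X d x r" by (auto simp: U(3) dball_def)
    ultimately show "x \<in> dtopology X d interior_of dball X d x r"
      using interior_of_mono by blast
  qed
next
  assume W: "well_behaved X d"
  show "hereditarily_quotient_map (cob_topology X d) (dtopology X d) (compression X d)"
    unfolding hereditarily_quotient_map_def
  proof (intro allI impI, elim conjE)
    fix U y assume U: "openin (cob_topology X d) U" and "y \<in> topspace (dtopology X d)"
      and sub: "{x \<in> topspace (cob_topology X d). compression X d x = y} \<subseteq> U"
    then have y: "y \<in> X" by simp
    with sub have "Vertex y \<in> U" by auto
    then obtain r where r: "r > 0" "dball X d y r \<subseteq> compression X d ` U"
      using ball_in_compression_image[OF ds U] by blast
    then have "y \<in> dtopology X d interior_of dball X d y r"
      using W y by (simp add: well_behaved_def)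
    then show "y \<in> dtopology X d interior_of (compression X d ` U)"
      using interior_of_mono[OF r(2)] by blast
  qed
qed

section \<open>The compression map of a cobweb\<close>

theorem theorem2p7:
  fixes X :: "'a set" and d :: "'a \<Rightarrow> 'a \<Rightarrow> real"
  assumes "distance_space X d"
  shows "(continuous_map (cob_topology X d) (dtopology X d) (compression X d) \<and>
          monotone_map (cob_topology X d) (dtopology X d) (compression X d) \<and>
          quotient_map (cob_topology X d) (dtopology X d) (compression X d) \<and>
          compression X d ` topspace (cob_topology X d) = topspace (dtopology X d)) \<and>
         (connected_space (cob_topology X d) \<longleftrightarrow> connected_space (dtopology X d)) \<and>
         (hereditarily_quotient_map (cob_topology X d) (dtopology X d) (compression X d)
            \<longleftrightarrow> well_behaved X d)"
proof -
  note quot = quotient_map_compression[OF assms]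
  have "connected_space (cob_topology X d) \<longleftrightarrow> connected_space (dtopology X d)"
    using connected_space_quotient_map_image[OF quot]
      connected_space_monotone_quotient_map_preimage[OF monotone_map_compression quot] by blast
  then show ?thesis
    using quot quotient_imp_continuous_map[OF quot] monotone_map_compression
      hereditarily_quotient_compression_iff[OF assms] by (simp add: compression_surj)
qed

end
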